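(* Let $(x_n)\subseteq\mathcal M$ be a sequence such that there exist $\sigma>0$ and $n_1$ such that for all $n\ge n_1$: (A1) $f(x_{n+1})-f(x_n)\le-\sigma\,g^-(x_n)\,\|x_{n+1}-x_n\|$, and (A2) $g^-(x_n)=0$ implies $x_{n+1}=x_n$. If there exists a cluster point $x^*\in\mathcal M$ of $(x_n)$ that satisfies the Łojasiewicz inequality (L) for the projected antigradient, with exponent $\theta\in(0,1/2]$, then $\lim_{n\to\infty}x_n=x^*$. If, further, there exist $\kappa>0$ and $n_2$ such that for all $n\ge n_2$ (A3) $\|x_{n+1}-x_n\|\ge\kappa\,g^-(x_n)$, then the following convergence rate estimate holds, where $\lesssim$ means inequality up to a multiplicative constant independent of $n$: \[ \|x_n-x^*\|\lesssim\begin{cases}e^{-cn}&\text{if }\theta=\tfrac12\ (\text{for some }c>0),\\ n^{-\frac{\theta}{1-2\theta}}&\text{if }0<\theta<\tfrac12.\end{cases} \] Moreover (in this case), $g^-(x_n)\to0$.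
   Context: $\mathcal D\subseteq\mathbb R^N$ is open, $f:\mathcal D\to\mathbb R$ is continuously differentiable and bounded below, $\mathcal M\subset\mathcal D$ is a closed set, and $\|\cdot\|$ is the Euclidean norm on $\mathbb R^N$. Tangent cone at $x\in\mathcal M$: $T_x\mathcal M=\{\xi\in\mathbb R^N:\exists (y_j)\subseteq\mathcal M,\ (a_j)\subseteq\mathbb R^+\text{ such that } y_j\to x,\ a_j(y_j-x)\to\xi\}$ (a closed cone, in general not convex). Norm of the projected antigradient: $g^-(x)=\sqrt{\|\nabla f(x)\|^2-\mathrm{dist}_{\|\cdot\|}(-\nabla f(x),T_x\mathcal M)^2}$; equivalently $g^-(x)=\max\{-\nabla f(x)^{\mathsf T}\xi:\xi\in T_x\mathcal M,\ \|\xi\|\le1\}$. A point $x\in\mathcal M$ satisfies the Łojasiewicz inequality (L) for the projected antigradient, with exponent $\theta$, if there exist $\delta>0$, $\Lambda>0$ and $\theta\in(0,1/2]$ such that $|f(y)-f(x)|^{1-\theta}\le\Lambda\,g^-(y)$ for all $y\in\mathcal M$ with $\|y-x\|<\delta$. *)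

theory Defs
  imports "HOL-Analysis.Analysis"
begin

definition gradient :: "('a::real_inner \<Rightarrow> real) \<Rightarrow> 'a \<Rightarrow> 'a" where
  "gradient f x = (THE g. GDERIV f x :> g)"

(* Outside the points of differentiability "gradient" is unspecified; this confirms that it
   is the intended vector wherever f is differentiable. *)
lemma gradient_eqI: "GDERIV f x :> g \<Longrightarrow> gradient f x = g"
proof -
  assume g: "GDERIV f x :> g"
  have "h = g" if "GDERIV f x :> h" for h
  proof -
    have "(\<lambda>v. v \<bullet> h) = (\<lambda>v. v \<bullet> g)"
      using has_derivative_unique[of f _ x] that g unfolding gderiv_def by blast
    then show ?thesis by (metis inner_commute vector_eq_rdot)
  qed
  with g show ?thesis unfolding gradient_def by blast
qed

lemma GDERIV_gradient:
  fixes f :: "'a::euclidean_space \<Rightarrow> real"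
  assumes "f differentiable (at x)"
  shows "GDERIV f x :> gradient f x"
proof -
  obtain F where F: "(f has_derivative F) (at x)"
    using assms unfolding differentiable_def by blast
  then have lin: "linear F" by (rule has_derivative_linear)
  have "F = (\<lambda>v. v \<bullet> adjoint F 1)"
    using adjoint_works[OF lin, of _ 1] by (auto simp: fun_eq_iff)
  with F have "GDERIV f x :> adjoint F 1" unfolding gderiv_def by simp
  then show ?thesis using gradient_eqI by metis
qed

definition C1_on :: "'a::euclidean_space set \<Rightarrow> ('a \<Rightarrow> real) \<Rightarrow> bool" where
  "C1_on D f \<longleftrightarrow> (\<forall>x\<in>D. f differentiable (at x)) \<and> continuous_on D (gradient f)"

definition tangent_cone :: "'a::real_normed_vector set \<Rightarrow> 'a \<Rightarrow> 'a set" where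
  "tangent_cone M x =
     {\<xi>. \<exists>(y :: nat \<Rightarrow> 'a) (a :: nat \<Rightarrow> real).
        (\<forall>j. y j \<in> M) \<and> (\<forall>j. a j > 0) \<and> y \<longlonglongrightarrow> x \<and>
        (\<lambda>j. a j *\<^sub>R (y j - x)) \<longlonglongrightarrow> \<xi>}"

(* For x in M the cone contains 0, so infdist is the genuine distance (its convention for the
   empty set is never used) and the argument of sqrt is nonnegative. *)
definition proj_antigrad_norm :: "('a::euclidean_space \<Rightarrow> real) \<Rightarrow> 'a set \<Rightarrow> 'a \<Rightarrow> real" where
  "proj_antigrad_norm f M x =
     sqrt ((norm (gradient f x))\<^sup>2 - (infdist (- gradient f x) (tangent_cone M x))\<^sup>2)"

definition lojasiewicz_at ::
  "('a::euclidean_space \<Rightarrow> real) \<Rightarrow> 'a set \<Rightarrow> 'a \<Rightarrow> real \<Rightarrow> bool" where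
  "lojasiewicz_at f M x \<theta> \<longleftrightarrow>
     0 < \<theta> \<and> \<theta> \<le> 1/2 \<and>
     (\<exists>\<delta>>0. \<exists>\<Lambda>>0. \<forall>y\<in>M. norm (y - x) < \<delta> \<longrightarrow>
        \<bar>f y - f x\<bar> powr (1 - \<theta>) \<le> \<Lambda> * proj_antigrad_norm f M y)"

definition seq_cluster_point :: "(nat \<Rightarrow> 'a::topological_space) \<Rightarrow> 'a \<Rightarrow> bool" where
  "seq_cluster_point x l \<longleftrightarrow>
     (\<forall>U. open U \<longrightarrow> l \<in> U \<longrightarrow> (\<exists>\<^sub>F n in sequentially. x n \<in> U))"

end

theory Submission
  imports Defs
begin

text \<open>
  Write \<open>e\<^sub>n = f (x\<^sub>n) - f x\<^sup>*\<close>, \<open>g\<^sub>n\<close> for the projected antigradient norm at \<open>x\<^sub>n\<close> and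
  \<open>s\<^sub>n\<close> for the length of the step from \<open>x\<^sub>n\<close> to its successor.  By the sufficient decrease
  condition \<open>\<sigma> g\<^sub>n s\<^sub>n \<le> e\<^sub>n - e\<^sub>n\<^sub>+\<^sub>1\<close> the values of \<open>f\<close> are eventually nonincreasing; since \<open>x\<^sup>*\<close>
  is a cluster point and \<open>f\<close> is continuous there, \<open>e\<^sub>n\<close> is eventually nonnegative and tends to \<open>0\<close>.  The concave function \<open>t \<mapsto> t\<^sup>\<theta>\<close> desingularizes \<open>f\<close>:
  its tangent inequality at \<open>e\<^sub>n\<close>, together with sufficient decrease and the Lojasiewicz
  inequality, gives
  \<open>s\<^sub>n \<le> \<phi>\<^sub>n - \<phi>\<^sub>n\<^sub>+\<^sub>1\<close> with \<open>\<phi>\<^sub>n = K e\<^sub>n\<^sup>\<theta>\<close> and \<open>K = \<Lambda> / (\<sigma>\<theta>)\<close>, as long as \<open>x\<^sub>n\<close> is near \<open>x\<^sup>*\<close>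
  (\<open>lojasiewicz_step_bound\<close>).

  The triangle inequality now makes \<open>\<parallel>x\<^sub>n - x\<^sup>*\<parallel> + \<phi>\<^sub>n\<close> nonincreasing while \<open>x\<^sub>n\<close> stays in the
  neighbourhood.  This quantity dominates the distance to \<open>x\<^sup>*\<close> and is arbitrarily small along a
  subsequence, so once it is small the sequence can no longer escape; this forces convergence.
  Likewise \<open>\<parallel>x\<^sub>n - x\<^sup>*\<parallel> - \<phi>\<^sub>n\<close> is nondecreasing with limit \<open>0\<close>, hence
  \<open>\<parallel>x\<^sub>n - x\<^sup>*\<parallel> \<le> \<phi>\<^sub>n\<close> (\<open>cluster_point_capture\<close>).

  It remains to estimate \<open>e\<^sub>n\<close>.  Combining sufficient decrease, the lower bound
  \<open>s\<^sub>n \<ge> \<kappa> g\<^sub>n\<close> on the steps and the Lojasiewicz inequality yields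
  \<open>e\<^sub>n - e\<^sub>n\<^sub>+\<^sub>1 \<ge> b e\<^sub>n\<^sup>2\<^sup>-\<^sup>2\<^sup>\<theta>\<close>, a discrete form of \<open>e' \<le> - b e\<^sup>2\<^sup>-\<^sup>2\<^sup>\<theta>\<close>.  For \<open>\<theta> = 1/2\<close> it gives
  exponential decay, and for \<open>\<theta> < 1/2\<close> it makes \<open>e\<^sub>n\<close> to the power \<open>- (1 - 2\<theta>)\<close> grow at least
  linearly as long as \<open>e\<^sub>n\<close> is positive (\<open>superlinear_decrease_powr_bound\<close>).
\<close>

section \<open>Tangent inequalities for powers\<close>

text \<open>
  This is the tangent inequality of the concave function \<open>t \<mapsto> t\<^sup>\<theta>\<close> at \<open>a\<close>, multiplied by
  \<open>a\<^sup>1\<^sup>-\<^sup>\<theta>\<close>; in this form it is the weighted inequality of arithmetic and geometric means, and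
  it stays meaningful at \<open>a = 0\<close>, where the derivative blows up if \<open>\<theta> < 1\<close>.
\<close>
lemma powr_concave_tangent:
  fixes a b \<theta> :: real
  assumes "0 \<le> b" "b \<le> a" "0 < \<theta>" "\<theta> \<le> 1"
  shows "\<theta> * (a - b) \<le> a powr (1 - \<theta>) * (a powr \<theta> - b powr \<theta>)"
proof (cases "b = 0")
  case True
  have "a powr (1 - \<theta>) * a powr \<theta> = a"
    using assms by (simp flip: powr_add)
  then show ?thesis using True assms
    by (simp add: mult_left_le_one_le)
next
  case False
  then have pos: "0 < b" "0 < a" using assms by auto
  have "b powr \<theta> * a powr (1 - \<theta>) \<le> \<theta> * b + (1 - \<theta>) * a"
    using Youngs_inequality_0[of \<theta> "1 - \<theta>" b a] pos assms by simp
  moreover have "a powr (1 - \<theta>) * a powr \<theta> = a"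
    using assms by (simp flip: powr_add)
  ultimately show ?thesis by (simp add: algebra_simps)
qed

text \<open>
  The tangent inequality of the convex function \<open>t \<mapsto> t\<^sup>-\<^sup>p\<close> at \<open>a\<close>.  In terms of \<open>t = b/a\<close> it
  says \<open>1 + p (1 - t) \<le> t\<^sup>-\<^sup>p\<close>, which follows from \<open>ln t \<le> t - 1\<close> and \<open>1 + u \<le> exp u\<close>.
\<close>
lemma powr_minus_convex_tangent:
  fixes a b p :: real
  assumes "0 < a" "0 < b" "0 \<le> p"
  shows "a powr - p + p * (a - b) * a powr (- p - 1) \<le> b powr - p"
proof -
  define t where "t = b / a"
  have t: "0 < t" and b: "b = a * t" using assms by (auto simp: t_def)
  have "p * ln t \<le> p * (t - 1)"
    using t assms by (intro mult_left_mono) (auto simp: ln_le_minus_one)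
  then have "1 + p * (1 - t) \<le> 1 + (- p * ln t)" by (simp add: algebra_simps)
  also have "\<dots> \<le> exp (- p * ln t)" by (rule exp_ge_add_one_self)
  also have "\<dots> = t powr - p" using t by (simp add: powr_def)
  finally have "a powr - p * (1 + p * (1 - t)) \<le> a powr - p * t powr - p"
    by (intro mult_left_mono) auto
  also have "\<dots> = b powr - p" using b t assms by (simp add: powr_mult)
  finally have "a powr - p * (1 + p * (1 - t)) \<le> b powr - p" .
  moreover have "(a - b) * a powr (- p - 1) = a powr - p * (1 - t)"
    using assms unfolding b by (simp add: powr_diff field_simps)
  then have "p * (a - b) * a powr (- p - 1) = p * (a powr - p * (1 - t))"
    by (simp add: mult.assoc)
  ultimately show ?thesis by (simp add: algebra_simps)
qed

section \<open>Convergence from the desingularized decrease\<close>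

text \<open>
  Here \<open>a\<close> and \<open>b\<close> are two consecutive values above the limit value and \<open>s\<close> is the length of
  the step.  The factor \<open>g\<close> cancels between the decrease condition and the Lojasiewicz
  inequality; when \<open>g = 0\<close> there is nothing to cancel, and the step vanishes by hypothesis.
\<close>
lemma lojasiewicz_step_bound:
  fixes a b g s \<sigma> \<theta> \<Lambda> :: real
  assumes "0 \<le> b" "b \<le> a" "0 < \<theta>" "\<theta> \<le> 1" "0 < \<sigma>" "0 < \<Lambda>" "0 \<le> g"
    and decrease: "\<sigma> * g * s \<le> a - b"
    and stationary: "g = 0 \<Longrightarrow> s = 0"
    and loja: "a powr (1 - \<theta>) \<le> \<Lambda> * g"
  shows "s \<le> \<Lambda> / (\<sigma> * \<theta>) * a powr \<theta> - \<Lambda> / (\<sigma> * \<theta>) * b powr \<theta>"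
proof -
  have diff: "0 \<le> a powr \<theta> - b powr \<theta>"
    using assms by (simp add: powr_mono2)
  have "s \<le> \<Lambda> / (\<sigma> * \<theta>) * (a powr \<theta> - b powr \<theta>)"
  proof (cases "g = 0")
    case True
    then show ?thesis using diff stationary assms by simp
  next
    case False
    have "\<theta> * (\<sigma> * g * s) \<le> \<theta> * (a - b)"
      using decrease assms by (intro mult_left_mono) auto
    also have "\<dots> \<le> a powr (1 - \<theta>) * (a powr \<theta> - b powr \<theta>)"
      using assms by (intro powr_concave_tangent) auto
    also have "\<dots> \<le> \<Lambda> * g * (a powr \<theta> - b powr \<theta>)"
      using loja diff by (rule mult_right_mono)
    finally have "g * (\<theta> * \<sigma> * s) \<le> g * (\<Lambda> * (a powr \<theta> - b powr \<theta>))"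
      by (simp add: mult_ac)
    then have "\<theta> * \<sigma> * s \<le> \<Lambda> * (a powr \<theta> - b powr \<theta>)"
      using False assms by (simp add: mult_le_cancel_left)
    then show ?thesis using assms by (simp add: field_simps)
  qed
  then show ?thesis by (simp add: right_diff_distrib)
qed

text \<open>
  A single value below \<open>c\<close> would keep all later values away from \<open>c\<close>, and a single value within
  \<open>\<epsilon>\<close> of \<open>c\<close> confines all later ones between \<open>c\<close> and \<open>c + \<epsilon>\<close>.
\<close>
lemma decreasing_cluster_point_limit:
  fixes v :: "nat \<Rightarrow> real"
  assumes step: "\<And>n. n \<ge> n1 \<Longrightarrow> v (Suc n) \<le> v n"
    and cluster: "\<And>\<epsilon>. \<epsilon> > 0 \<Longrightarrow> \<exists>\<^sub>F n in sequentially. \<bar>v n - c\<bar> < \<epsilon>"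
  shows "\<forall>n\<ge>n1. c \<le> v n" and "v \<longlonglongrightarrow> c"
proof -
  have mono: "v n \<le> v m" if "n1 \<le> m" "m \<le> n" for m n
    using that(2)
  proof (induction n rule: dec_induct)
    case (step n)
    then show ?case using assms(1)[of n] \<open>n1 \<le> m\<close> by simp
  qed simp
  have often: "\<exists>n\<ge>m. \<bar>v n - c\<bar> < \<epsilon>" if "\<epsilon> > 0" for \<epsilon> m
    using cluster[OF that] by (auto simp: frequently_sequentially)
  show lower: "\<forall>n\<ge>n1. c \<le> v n"
  proof (intro allI impI, rule ccontr)
    fix m assume m: "n1 \<le> m" "\<not> c \<le> v m"
    obtain n where n: "n \<ge> m" "\<bar>v n - c\<bar> < c - v m"
      using often[of "c - v m" m] m by auto
    with mono[of m n] m show False by simp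
  qed
  show "v \<longlonglongrightarrow> c"
  proof (rule LIMSEQ_I)
    fix r :: real assume "0 < r"
    then obtain m where m: "m \<ge> n1" "\<bar>v m - c\<bar> < r" using often[of r n1] by auto
    have "norm (v n - c) < r" if "n \<ge> m" for n
      using mono[OF m(1) that] lower that m by simp
    then show "\<exists>no. \<forall>n\<ge>no. norm (v n - c) < r" by blast
  qed
qed

text \<open>
  The step bound is known only inside the ball, so it cannot simply be summed.  The quantity
  \<open>\<parallel>x\<^sub>n - l\<parallel> + \<phi>\<^sub>n\<close> resolves the circularity: being below \<open>\<delta>\<close> puts \<open>x\<^sub>n\<close> in the ball, and then
  the step bound keeps it from increasing.
\<close>
lemma cluster_point_capture:
  fixes x :: "nat \<Rightarrow> 'a::real_normed_vector" and \<phi> :: "nat \<Rightarrow> real"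
  assumes step: "\<And>n. n \<ge> n1 \<Longrightarrow> norm (x n - l) < \<delta>
      \<Longrightarrow> norm (x (Suc n) - x n) \<le> \<phi> n - \<phi> (Suc n)"
    and nonneg: "\<And>n. n \<ge> n1 \<Longrightarrow> 0 \<le> \<phi> n"
    and lim: "\<phi> \<longlonglongrightarrow> 0"
    and cluster: "seq_cluster_point x l"
    and "0 < \<delta>"
  shows "x \<longlonglongrightarrow> l"
    and "\<forall>\<^sub>F n in sequentially. norm (x n - l) \<le> \<phi> n"
proof -
  define d where "d n = norm (x n - l) + \<phi> n" for n
  have in_ball: "norm (x n - l) < \<delta>" if "n \<ge> n1" "d n < \<delta>" for n
    using nonneg[OF that(1)] that(2) by (simp add: d_def)
  have d_step: "d (Suc n) \<le> d n" if "n \<ge> n1" "d n < \<delta>" for n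
  proof -
    have "norm (x (Suc n) - l) \<le> norm (x (Suc n) - x n) + norm (x n - l)"
      using norm_triangle_ineq[of "x (Suc n) - x n" "x n - l"] by simp
    then show ?thesis
      using step[OF that(1) in_ball[OF that]] by (simp add: d_def)
  qed
  have small: "\<exists>m\<ge>n1. \<forall>n\<ge>m. d n < \<epsilon>" if \<epsilon>: "0 < \<epsilon>" "\<epsilon> \<le> \<delta>" for \<epsilon>
  proof -
    obtain m1 where m1: "\<And>n. n \<ge> m1 \<Longrightarrow> \<bar>\<phi> n\<bar> < \<epsilon> / 2"
      using LIMSEQ_D[OF lim, of "\<epsilon> / 2"] \<epsilon> by auto
    have "\<exists>\<^sub>F n in sequentially. x n \<in> ball l (\<epsilon> / 2)"
      using cluster \<epsilon> unfolding seq_cluster_point_def by (meson centre_in_ball half_gt_zero open_ball)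
    then obtain m where m: "m \<ge> max n1 m1" "x m \<in> ball l (\<epsilon> / 2)"
      unfolding frequently_sequentially by blast
    have dm: "d m < \<epsilon>"
      using m m1[of m] by (simp add: d_def dist_norm norm_minus_commute)
    have "d n < \<epsilon>" if "n \<ge> m" for n
      using that
    proof (induction n rule: dec_induct)
      case base then show ?case by (rule dm)
    next
      case (step n)
      then show ?case using d_step[of n] m \<epsilon> by simp
    qed
    then show ?thesis using m by auto
  qed
  show conv: "x \<longlonglongrightarrow> l"
  proof (rule LIMSEQ_I)
    fix r :: real assume "0 < r"
    then obtain m where m: "m \<ge> n1" "\<forall>n\<ge>m. d n < min r \<delta>"
      using small[of "min r \<delta>"] \<open>0 < \<delta>\<close> by auto
    have "norm (x n - l) < r" if "n \<ge> m" for n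
      using m that nonneg[of n] by (auto simp: d_def dest: spec[of _ n])
    then show "\<exists>no. \<forall>n\<ge>no. norm (x n - l) < r" by blast
  qed
  obtain m where m: "m \<ge> n1" "\<forall>n\<ge>m. d n < \<delta>" using small[of \<delta>] \<open>0 < \<delta>\<close> by auto
  \<comment> \<open>The difference of distance and \<open>\<phi>\<close> increases to its limit \<open>0\<close>, so it is never positive.\<close>
  have "norm (x n - l) \<le> \<phi> n" if n: "n \<ge> m" for n
  proof -
    have incr: "norm (x n - l) - \<phi> n \<le> norm (x k - l) - \<phi> k" if "k \<ge> n" for k
      using that
    proof (induction k rule: dec_induct)
      case (step k)
      have k: "k \<ge> n1" "d k < \<delta>" using m n step by auto
      have "norm (x k - l) \<le> norm (x (Suc k) - l) + norm (x (Suc k) - x k)"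
        using norm_triangle_ineq4[of "x (Suc k) - l" "x (Suc k) - x k"] by simp
      then show ?case
        using assms(1)[OF k(1) in_ball[OF k]] step.IH by simp
    qed simp
    have "(\<lambda>k. norm (x k - l) - \<phi> k) \<longlonglongrightarrow> 0 - 0"
      using conv lim by (intro tendsto_diff) (auto simp: LIM_zero tendsto_norm_zero)
    then have "norm (x n - l) - \<phi> n \<le> 0"
      using incr by (intro LIMSEQ_le_const[where x = 0]) auto
    then show ?thesis by simp
  qed
  then show "\<forall>\<^sub>F n in sequentially. norm (x n - l) \<le> \<phi> n"
    unfolding eventually_sequentially by blast
qed

section \<open>Rates for the decreasing values\<close>

text \<open>
  Each step multiplies \<open>e\<^sub>n\<close> by at most \<open>1 - b \<le> exp (- b)\<close>.
\<close>
lemma linear_decrease_exp_bound: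
  fixes e :: "nat \<Rightarrow> real"
  assumes nonneg: "\<And>n. n \<ge> m \<Longrightarrow> 0 \<le> e n"
    and decrease: "\<And>n. n \<ge> m \<Longrightarrow> b * e n \<le> e n - e (Suc n)"
    and "n \<ge> m"
  shows "e n \<le> e m * exp (- b * real (n - m))"
  using \<open>n \<ge> m\<close>
proof (induction n rule: dec_induct)
  case (step n)
  have "e (Suc n) \<le> e n * (1 - b)"
    using decrease[of n] step by (simp add: algebra_simps)
  also have "\<dots> \<le> e n * exp (- b)"
    using exp_ge_add_one_self[of "- b"] nonneg[of n] step by (intro mult_left_mono) auto
  also have "\<dots> \<le> e m * exp (- b * real (n - m)) * exp (- b)"
    using step by (intro mult_right_mono) auto
  also have "\<dots> = e m * exp (- b * real (Suc n - m))"
    using step by (simp add: mult.assoc Suc_diff_le algebra_simps flip: exp_add)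
  finally show ?case .
qed simp

text \<open>
  By convexity, each step raises the value of \<open>e\<^sub>n\<^sup>-\<^sup>p\<close> by at least \<open>p b\<close>, just as the differential
  inequality \<open>e' \<le> - b e\<^sup>1\<^sup>+\<^sup>p\<close> gives \<open>(e\<^sup>-\<^sup>p)' \<ge> p b\<close>.  Only positive values can be inverted, which
  suffices since the sequence is nonincreasing.
\<close>
lemma superlinear_decrease_powr_bound:
  fixes e :: "nat \<Rightarrow> real"
  assumes nonneg: "\<And>n. n \<ge> m \<Longrightarrow> 0 \<le> e n"
    and decrease: "\<And>n. n \<ge> m \<Longrightarrow> b * e n powr (1 + p) \<le> e n - e (Suc n)"
    and "0 < b" "0 < p" "n > m"
  shows "e n \<le> (p * b * real (n - m)) powr (- 1 / p)"
proof (cases "e n = 0")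
  case False
  with nonneg[of n] \<open>n > m\<close> have pos: "0 < e n" by force
  have "0 < e n \<longrightarrow> p * b * real (n - m) \<le> e n powr - p"
    using less_imp_le[OF \<open>n > m\<close>]
  proof (induction n rule: dec_induct)
    case (step n)
    show ?case
    proof
      assume pos': "0 < e (Suc n)"
      have "0 \<le> b * e n powr (1 + p)" using \<open>0 < b\<close> by simp
      with decrease[of n] step pos' have pos: "0 < e n" by force
      have "p * b = p * (b * e n powr (1 + p)) * e n powr (- p - 1)"
        using pos by (simp add: mult.assoc flip: powr_add)
      also have "\<dots> \<le> p * (e n - e (Suc n)) * e n powr (- p - 1)"
        using decrease[of n] step \<open>0 < p\<close> by (intro mult_right_mono mult_left_mono) auto
      finally have "p * b \<le> p * (e n - e (Suc n)) * e n powr (- p - 1)" .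
      with powr_minus_convex_tangent[of "e n" "e (Suc n)" p] pos pos' \<open>0 < p\<close>
      have "e n powr - p + p * b \<le> e (Suc n) powr - p" by linarith
      then show "p * b * real (Suc n - m) \<le> e (Suc n) powr - p"
        using step pos by (simp add: Suc_diff_le algebra_simps)
    qed
  qed simp
  then have "p * b * real (n - m) \<le> e n powr - p" using pos by simp
  then have "(e n powr - p) powr (- 1 / p) \<le> (p * b * real (n - m)) powr (- 1 / p)"
    using assms by (intro powr_mono2') auto
  also have "(e n powr - p) powr (- 1 / p) = e n"
    using pos \<open>0 < p\<close> by (simp add: powr_powr)
  finally show ?thesis .
qed simp

text \<open>
  The finitely many exceptional indices are absorbed into the constant, which is where the
  positivity of the comparison sequence enters.
\<close>
lemma eventually_bounded_imp_bounded_from: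
  fixes a r :: "nat \<Rightarrow> real"
  assumes ev: "\<forall>\<^sub>F n in sequentially. a n \<le> C * r n"
    and pos: "\<And>n. n \<ge> k \<Longrightarrow> 0 < r n"
  shows "\<exists>C. \<forall>n\<ge>k. a n \<le> C * r n"
proof -
  obtain N where N: "\<And>n. n \<ge> N \<Longrightarrow> a n \<le> C * r n"
    using ev by (auto simp: eventually_sequentially)
  define C' where "C' = \<bar>C\<bar> + (\<Sum>i<N. \<bar>a i / r i\<bar>)"
  have "a n \<le> C' * r n" if n: "n \<ge> k" for n
  proof (cases "n < N")
    case True
    have "a n / r n \<le> \<bar>a n / r n\<bar>" by (rule abs_ge_self)
    also have "\<dots> \<le> (\<Sum>i<N. \<bar>a i / r i\<bar>)"
      using True by (intro member_le_sum) auto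
    also have "\<dots> \<le> C'" by (simp add: C'_def)
    finally show ?thesis using pos[OF n] by (simp add: field_simps)
  next
    case False
    have "0 \<le> (\<Sum>i<N. \<bar>a i / r i\<bar>)" by (intro sum_nonneg) auto
    then have "C \<le> C'" unfolding C'_def by linarith
    then have "C * r n \<le> C' * r n" using pos[OF n] by (intro mult_right_mono) auto
    then show ?thesis using N[of n] False by simp
  qed
  then show ?thesis by blast
qed

section \<open>Convergence and rates under the Lojasiewicz inequality\<close>

text \<open>
  The vertex of the tangent cone is at distance \<open>\<parallel>\<nabla>f\<parallel>\<close> from the antigradient, so the argument
  of the square root is nonnegative.
\<close>
lemma proj_antigrad_norm_nonneg:
  assumes "y \<in> M"
  shows "0 \<le> proj_antigrad_norm f M y"
proof -
  have "0 \<in> tangent_cone M y"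
    unfolding tangent_cone_def using assms
    by (auto intro!: exI[of _ "\<lambda>_. y"] exI[of _ "\<lambda>_. 1 :: real"])
  then have "infdist (- gradient f y) (tangent_cone M y) \<le> dist (- gradient f y) 0"
    by (rule infdist_le)
  then show ?thesis
    unfolding proj_antigrad_norm_def by (simp add: power_mono infdist_nonneg)
qed

theorem theorem2p3:
  fixes D M :: "(real ^ 'n) set"
    and f :: "real ^ 'n \<Rightarrow> real"
    and x :: "nat \<Rightarrow> real ^ 'n"
    and xs :: "real ^ 'n"
    and \<theta> :: real
  assumes "open D"
    and "C1_on D f"
    and "bdd_below (f ` D)"
    and "closed M" and "M \<subseteq> D"
    and "\<forall>n. x n \<in> M"
    and A1_A2: "\<exists>\<sigma>>0. \<exists>n1. \<forall>n\<ge>n1.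
          f (x (Suc n)) - f (x n)
            \<le> - \<sigma> * proj_antigrad_norm f M (x n) * norm (x (Suc n) - x n)
          \<and> (proj_antigrad_norm f M (x n) = 0 \<longrightarrow> x (Suc n) = x n)"
    and "xs \<in> M"
    and "seq_cluster_point x xs"
    and "lojasiewicz_at f M xs \<theta>"
  shows "x \<longlonglongrightarrow> xs
    \<and> ((\<exists>\<kappa>>0. \<exists>n2. \<forall>n\<ge>n2.
            norm (x (Suc n) - x n) \<ge> \<kappa> * proj_antigrad_norm f M (x n))
        \<longrightarrow>
          (\<theta> = 1/2 \<longrightarrow>
             (\<exists>c>0. \<exists>C. \<forall>n. norm (x n - xs) \<le> C * exp (- c * real n)))
        \<and> (\<theta> < 1/2 \<longrightarrow>
             (\<exists>C. \<forall>n\<ge>1. norm (x n - xs) \<le> C * real n powr (- \<theta> / (1 - 2 * \<theta>))))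
        \<and> (\<lambda>n. proj_antigrad_norm f M (x n)) \<longlonglongrightarrow> 0)"
proof -
  define g where "g n = proj_antigrad_norm f M (x n)" for n
  define s where "s n = norm (x (Suc n) - x n)" for n
  define e where "e n = f (x n) - f xs" for n
  have g_nonneg: "0 \<le> g n" for n
    unfolding g_def using assms by (intro proj_antigrad_norm_nonneg) auto
  obtain \<sigma> n1 where \<sigma>: "0 < \<sigma>"
    and A1: "\<And>n. n \<ge> n1 \<Longrightarrow> \<sigma> * g n * s n \<le> f (x n) - f (x (Suc n))"
    and A2: "\<And>n. n \<ge> n1 \<Longrightarrow> g n = 0 \<Longrightarrow> s n = 0"
    using A1_A2 unfolding g_def s_def by (auto simp: algebra_simps)
  obtain \<delta> \<Lambda> where \<theta>: "0 < \<theta>" "\<theta> \<le> 1/2" and \<delta>: "0 < \<delta>" and \<Lambda>: "0 < \<Lambda>"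
    and loja': "\<And>y. y \<in> M \<Longrightarrow> norm (y - xs) < \<delta>
      \<Longrightarrow> \<bar>f y - f xs\<bar> powr (1 - \<theta>) \<le> \<Lambda> * proj_antigrad_norm f M y"
    using \<open>lojasiewicz_at f M xs \<theta>\<close> unfolding lojasiewicz_at_def by auto

  have "f differentiable (at xs)"
    using \<open>C1_on D f\<close> \<open>xs \<in> M\<close> \<open>M \<subseteq> D\<close> unfolding C1_on_def by blast
  then have cont: "isCont f xs" by (rule differentiable_imp_continuous_within)
  have cluster_f: "\<exists>\<^sub>F n in sequentially. \<bar>f (x n) - f xs\<bar> < \<epsilon>" if "\<epsilon> > 0" for \<epsilon>
  proof -
    obtain U where U: "open U" "xs \<in> U" "\<And>y. y \<in> U \<Longrightarrow> dist (f y) (f xs) < \<epsilon>"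
      using cont \<open>\<epsilon> > 0\<close> unfolding continuous_at_open
      by (metis (no_types, lifting) centre_in_ball dist_commute mem_ball open_ball)
    have "\<exists>\<^sub>F n in sequentially. x n \<in> U"
      using \<open>seq_cluster_point x xs\<close> U unfolding seq_cluster_point_def by blast
    then show ?thesis
      by (rule frequently_elim1) (use U in \<open>auto simp: dist_real_def\<close>)
  qed
  have decr: "f (x (Suc n)) \<le> f (x n)" if "n \<ge> n1" for n
  proof -
    have "0 \<le> \<sigma> * g n * s n" using \<sigma> g_nonneg by (simp add: s_def)
    then show ?thesis using A1[OF that] by simp
  qed
  have f_limit: "\<forall>n\<ge>n1. f xs \<le> f (x n)" "(\<lambda>n. f (x n)) \<longlonglongrightarrow> f xs"
    by (rule decreasing_cluster_point_limit[of n1 "\<lambda>n. f (x n)"]; fact decr cluster_f)+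
  have e_nonneg: "0 \<le> e n" if "n \<ge> n1" for n
    using f_limit(1) that by (simp add: e_def)
  have e_lim: "e \<longlonglongrightarrow> 0"
    unfolding e_def using f_limit(2) by (rule LIM_zero)
  have loja: "e n powr (1 - \<theta>) \<le> \<Lambda> * g n" if "n \<ge> n1" "norm (x n - xs) < \<delta>" for n
    using loja'[of "x n"] that e_nonneg[of n] assms by (simp add: e_def g_def)

  define K where "K = \<Lambda> / (\<sigma> * \<theta>)"
  have K: "0 < K" using \<theta> \<sigma> \<Lambda> by (simp add: K_def)
  define \<phi> where "\<phi> n = K * e n powr \<theta>" for n
  have step: "norm (x (Suc n) - x n) \<le> \<phi> n - \<phi> (Suc n)"
    if n: "n \<ge> n1" "norm (x n - xs) < \<delta>" for n
    using lojasiewicz_step_bound[of "e (Suc n)" "e n" \<theta> \<sigma> \<Lambda> "g n" "s n"]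
      e_nonneg[of "Suc n"] decr[of n] A1[of n] A2[of n] loja[of n] \<theta> \<sigma> \<Lambda> g_nonneg n
    by (simp add: \<phi>_def K_def e_def s_def)
  have "(\<lambda>n. e n powr \<theta>) \<longlonglongrightarrow> 0"
    using e_lim \<theta> by (intro tendsto_zero_powrI[where b = \<theta>])
      (auto intro: eventually_sequentiallyI[of n1] e_nonneg)
  then have \<phi>_lim: "\<phi> \<longlonglongrightarrow> 0"
    unfolding \<phi>_def by (rule tendsto_mult_right_zero)
  have \<phi>_nonneg: "0 \<le> \<phi> n" if "n \<ge> n1" for n using K by (simp add: \<phi>_def)
  have conv: "x \<longlonglongrightarrow> xs"
    by (rule cluster_point_capture(1)[of n1 x xs \<delta> \<phi>];
        fact step \<phi>_nonneg \<phi>_lim \<open>seq_cluster_point x xs\<close> \<delta>)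
  have dist_bound: "\<forall>\<^sub>F n in sequentially. norm (x n - xs) \<le> \<phi> n"
    by (rule cluster_point_capture(2)[of n1 x xs \<delta> \<phi>];
        fact step \<phi>_nonneg \<phi>_lim \<open>seq_cluster_point x xs\<close> \<delta>)

  have rates: "(\<theta> = 1/2 \<longrightarrow>
             (\<exists>c>0. \<exists>C. \<forall>n. norm (x n - xs) \<le> C * exp (- c * real n)))
        \<and> (\<theta> < 1/2 \<longrightarrow>
             (\<exists>C. \<forall>n\<ge>1. norm (x n - xs) \<le> C * real n powr (- \<theta> / (1 - 2 * \<theta>))))
        \<and> g \<longlonglongrightarrow> 0"
    if \<kappa>: "0 < \<kappa>" and A3: "\<And>n. n \<ge> n2 \<Longrightarrow> \<kappa> * g n \<le> s n" for \<kappa> n2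
  proof -
    have "\<forall>\<^sub>F n in sequentially. norm (x n - xs) < \<delta> \<and> norm (x n - xs) \<le> \<phi> n
        \<and> n \<ge> n1 \<and> n \<ge> n2"
      using dist_bound eventually_ge_at_top[of n1] eventually_ge_at_top[of n2]
        tendstoD[OF conv \<delta>] by eventually_elim (simp add: dist_norm)
    then obtain m where m: "\<And>n. n \<ge> m \<Longrightarrow> norm (x n - xs) < \<delta> \<and> norm (x n - xs) \<le> \<phi> n
        \<and> n \<ge> n1 \<and> n \<ge> n2"
      by (auto simp: eventually_sequentially)
    have e_nonneg': "0 \<le> e n" if "n \<ge> m" for n using e_nonneg m that by blast
    \<comment> \<open>This constant turns \<open>\<sigma> g\<^sub>n s\<^sub>n \<ge> \<sigma> \<kappa> g\<^sub>n\<^sup>2\<close> into a bound by \<open>e\<^sub>n\<close>, using \<open>g\<^sub>n \<ge> e\<^sub>n\<^sup>1\<^sup>-\<^sup>\<theta> / \<Lambda>\<close>.\<close>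
    define b where "b = \<sigma> * \<kappa> / \<Lambda>\<^sup>2"
    have b: "0 < b" using \<sigma> \<kappa> \<Lambda> by (simp add: b_def)
    have decrease: "b * e n powr (2 - 2 * \<theta>) \<le> e n - e (Suc n)" if n: "n \<ge> m" for n
    proof -
      have "e n powr (2 - 2 * \<theta>) = (e n powr (1 - \<theta>))\<^sup>2"
        by (simp add: power2_eq_square flip: powr_add)
      also have "\<dots> \<le> (\<Lambda> * g n)\<^sup>2"
        using loja[of n] m[OF n] by (intro power_mono) auto
      finally have "b * e n powr (2 - 2 * \<theta>) \<le> b * (\<Lambda> * g n)\<^sup>2"
        using b by (intro mult_left_mono) auto
      also have "\<dots> = \<sigma> * g n * (\<kappa> * g n)"
        using \<Lambda> by (simp add: b_def power2_eq_square)
      also have "\<dots> \<le> \<sigma> * g n * s n"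
        using A3[of n] m[OF n] \<sigma> g_nonneg[of n] by (intro mult_left_mono) auto
      also have "\<dots> \<le> e n - e (Suc n)"
        using A1[of n] m[OF n] by (simp add: e_def)
      finally show ?thesis .
    qed

    have exp_rate: "\<exists>c>0. \<exists>C. \<forall>n. norm (x n - xs) \<le> C * exp (- c * real n)"
      if half: "\<theta> = 1/2"
    proof -
      define C where "C = K * (e m * exp (b * real m)) powr \<theta>"
      have "norm (x n - xs) \<le> C * exp (- (b / 2) * real n)" if n: "n \<ge> m" for n
      proof -
        have "e n \<le> e m * exp (- b * real (n - m))"
        proof (rule linear_decrease_exp_bound[of m e b n])
          show "b * e k \<le> e k - e (Suc k)" if "k \<ge> m" for k
            using decrease[OF that] e_nonneg'[OF that] half by simp
        qed (fact e_nonneg' n)+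
        also have "\<dots> = e m * exp (b * real m) * exp (- b * real n)"
          using n by (simp add: of_nat_diff mult.assoc algebra_simps flip: exp_add)
        finally have "e n powr \<theta> \<le> (e m * exp (b * real m) * exp (- b * real n)) powr \<theta>"
          using e_nonneg' n \<theta> by (intro powr_mono2) auto
        also have "\<dots> = (e m * exp (b * real m)) powr \<theta> * exp (- (b / 2) * real n)"
          using half e_nonneg'[of m] by (simp add: powr_mult exp_powr_real)
        finally have "\<phi> n \<le> C * exp (- (b / 2) * real n)"
          using K by (simp add: \<phi>_def C_def mult.assoc)
        then show ?thesis using m[OF n] by linarith
      qed
      then have "\<forall>\<^sub>F n in sequentially. norm (x n - xs) \<le> C * exp (- (b / 2) * real n)"
        by (rule eventually_sequentiallyI)
      then have "\<exists>C. \<forall>n\<ge>0. norm (x n - xs) \<le> C * exp (- (b / 2) * real n)"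
        by (rule eventually_bounded_imp_bounded_from) simp
      then show ?thesis using b by (intro exI[of _ "b / 2"]) auto
    qed

    have powr_rate: "\<exists>C. \<forall>n\<ge>1. norm (x n - xs) \<le> C * real n powr (- \<theta> / (1 - 2 * \<theta>))"
      if less: "\<theta> < 1/2"
    proof -
      define p where "p = 1 - 2 * \<theta>"
      have p: "0 < p" using less by (simp add: p_def)
      define C where "C = K * (p * b / 2) powr (- \<theta> / p)"
      \<comment> \<open>From \<open>2 m + 1\<close> on, \<open>n - m\<close> is at least \<open>n/2\<close> and positive, so the shift by \<open>m\<close> costs
        only a constant factor.\<close>
      have "norm (x n - xs) \<le> C * real n powr (- \<theta> / p)" if n: "n \<ge> 2 * m + 1" for n
      proof -
        have "e n \<le> (p * b * real (n - m)) powr (- 1 / p)"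
        proof (rule superlinear_decrease_powr_bound)
          show "b * e k powr (1 + p) \<le> e k - e (Suc k)" if "k \<ge> m" for k
            using decrease[OF that] by (simp add: p_def)
        qed (use e_nonneg' b p n in auto)
        also have "\<dots> \<le> (p * b / 2 * real n) powr (- 1 / p)"
        proof (rule powr_mono2')
          have "real n / 2 \<le> real (n - m)" using n by (simp add: of_nat_diff)
          then show "p * b / 2 * real n \<le> p * b * real (n - m)"
            using mult_left_mono[of "real n / 2" "real (n - m)" "p * b"] p b by simp
        qed (use p b n in auto)
        finally have "e n powr \<theta> \<le> ((p * b / 2 * real n) powr (- 1 / p)) powr \<theta>"
          using e_nonneg' n \<theta> by (intro powr_mono2) auto
        also have "\<dots> = (p * b / 2 * real n) powr (- \<theta> / p)"
          by (simp add: powr_powr)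
        also have "\<dots> = (p * b / 2) powr (- \<theta> / p) * real n powr (- \<theta> / p)"
          using p b by (intro powr_mult)
        finally have "\<phi> n \<le> C * real n powr (- \<theta> / p)"
          using K by (simp add: \<phi>_def C_def mult.assoc)
        then show ?thesis using m[of n] n by simp
      qed
      then have "\<forall>\<^sub>F n in sequentially. norm (x n - xs) \<le> C * real n powr (- \<theta> / p)"
        by (rule eventually_sequentiallyI)
      then have "\<exists>C. \<forall>n\<ge>1. norm (x n - xs) \<le> C * real n powr (- \<theta> / p)"
        by (rule eventually_bounded_imp_bounded_from) simp
      then show ?thesis by (simp add: p_def)
    qed

    have "s \<longlonglongrightarrow> norm (xs - xs)"
      unfolding s_def using conv LIMSEQ_Suc[OF conv] by (intro tendsto_intros)
    then have "(\<lambda>n. s n / \<kappa>) \<longlonglongrightarrow> 0"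
      using tendsto_divide_zero by simp
    then have "g \<longlonglongrightarrow> 0"
    proof (rule tendsto_sandwich[OF _ _ tendsto_const, rotated 2])
      show "\<forall>\<^sub>F n in sequentially. g n \<le> s n / \<kappa>"
        using A3 \<kappa> by (intro eventually_sequentiallyI[of n2]) (simp add: field_simps)
    qed (simp add: g_nonneg)
    with exp_rate powr_rate show ?thesis by blast
  qed
  show ?thesis
  proof (intro conjI[OF conv] impI)
    assume "\<exists>\<kappa>>0. \<exists>n2. \<forall>n\<ge>n2.
            norm (x (Suc n) - x n) \<ge> \<kappa> * proj_antigrad_norm f M (x n)"
    then obtain \<kappa> n2 where \<kappa>: "0 < \<kappa>" "\<And>n. n \<ge> n2 \<Longrightarrow> \<kappa> * g n \<le> s n"
      unfolding g_def s_def by blast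
    show "(\<theta> = 1/2 \<longrightarrow>
             (\<exists>c>0. \<exists>C. \<forall>n. norm (x n - xs) \<le> C * exp (- c * real n)))
        \<and> (\<theta> < 1/2 \<longrightarrow>
             (\<exists>C. \<forall>n\<ge>1. norm (x n - xs) \<le> C * real n powr (- \<theta> / (1 - 2 * \<theta>))))
        \<and> (\<lambda>n. proj_antigrad_norm f M (x n)) \<longlonglongrightarrow> 0"
      using rates[OF \<kappa>] unfolding g_def .
  qed
qed

end
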